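(* Let $(S,\mathcal{S},\hat{\mathcal{S}})$ be a localized Borel space and let $\mathcal{I}\subset\hat{\mathcal{S}}$ be a generating semi-ring. Then, for any random signed measures $\xi$ and $\eta$ on $S$, we have $\xi\stackrel{d}{=}\eta$ if and only if $(\xi(I_1),\dots,\xi(I_n))\stackrel{d}{=}(\eta(I_1),\dots,\eta(I_n))$ for every $n\in\mathbb{N}$ and every $I_1,\dots,I_n\in\mathcal{I}$.
   Context: A localized Borel space $(S,\mathcal{S},\hat{\mathcal{S}})$ consists of a Borel space $(S,\mathcal{S})$ and a localizing ring $\hat{\mathcal{S}}$, i.e. a ring $\hat{\mathcal{S}}\subset\mathcal{S}$ such that $B\cap C\in\hat{\mathcal{S}}$ for all $B\in\hat{\mathcal{S}}$, $C\in\mathcal{S}$, and $\hat{\mathcal{S}}=\bigcup_n(\mathcal{S}\cap S_n)$ for some sets $S_n\uparrow S$ in $\hat{\mathcal{S}}$, where $\mathcal{S}\cap S_n=\{C\cap S_n:C\in\mathcal{S}\}$. A class $\mathcal{I}\subset\hat{\mathcal{S}}$ is generating if the $\sigma$-ring generated by $\mathcal{I}$ is $\mathcal{S}$. $\mathsf{M}_S$ is the space of countably additive set functions $\mu:\hat{\mathcal{S}}\to\mathbb{R}$ ($\mu(\emptyset)=0$ and $\mu(\bigcup_k A_k)=\sum_k\mu(A_k)$, absolutely convergent, for disjoint $A_k\in\hat{\mathcal{S}}$ with union in $\hat{\mathcal{S}}$), with the $\sigma$-algebra $\mathcal{B}_{\mathsf{M}_S}$ generated by the maps $\mu\mapsto\mu(B)$,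 $B\in\hat{\mathcal{S}}$. A random signed measure on $S$ is a measurable map from a probability space to $(\mathsf{M}_S,\mathcal{B}_{\mathsf{M}_S})$; $\xi\stackrel{d}{=}\eta$ means equality of laws on $(\mathsf{M}_S,\mathcal{B}_{\mathsf{M}_S})$. *)

theory Defs
  imports "HOL-Probability.Probability"
begin

text \<open>
  Measurable spaces are represented by \<^typ>\<open>'a measure\<close>, of which only \<^const>\<open>space\<close> and
  \<^const>\<open>sets\<close> are used. A Borel space is one that is isomorphic, as a measurable space, to a Borel
  subset of the real line.
\<close>

definition is_Borel_space :: "'a measure \<Rightarrow> bool" where
  "is_Borel_space S \<longleftrightarrow>
    (\<exists>A \<in> sets (borel :: real measure). \<exists>f g.
       f \<in> S \<rightarrow>\<^sub>M restrict_space borel A \<and> g \<in> restrict_space borel A \<rightarrow>\<^sub>M S \<and>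
       (\<forall>x \<in> space S. g (f x) = x) \<and> (\<forall>y \<in> A. f (g y) = y))"

definition localizing_ring :: "'a measure \<Rightarrow> 'a set set \<Rightarrow> bool" where
  "localizing_ring S L \<longleftrightarrow>
    ring_of_sets (space S) L \<and> L \<subseteq> sets S \<and>
    (\<forall>B \<in> L. \<forall>C \<in> sets S. B \<inter> C \<in> L) \<and>
    (\<exists>Sn :: nat \<Rightarrow> 'a set. range Sn \<subseteq> L \<and> incseq Sn \<and> (\<Union>n. Sn n) = space S \<and>
       L = (\<Union>n. {C \<inter> Sn n | C. C \<in> sets S}))"

definition localized_Borel_space :: "'a measure \<Rightarrow> 'a set set \<Rightarrow> bool" where
  "localized_Borel_space S L \<longleftrightarrow> is_Borel_space S \<and> localizing_ring S L"

text \<open>The \<open>\<sigma>\<close>-ring generated by a class of sets; unlike \<^const>\<open>sigma_sets\<close>, it is closed under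
  differences but not under complements in an ambient space.\<close>

inductive_set sigma_ring_sets :: "'a set set \<Rightarrow> 'a set set" for I :: "'a set set" where
  Basic: "A \<in> I \<Longrightarrow> A \<in> sigma_ring_sets I"
| Empty: "{} \<in> sigma_ring_sets I"
| Diff: "A \<in> sigma_ring_sets I \<Longrightarrow> B \<in> sigma_ring_sets I \<Longrightarrow> A - B \<in> sigma_ring_sets I"
| Union: "(\<And>i::nat. A i \<in> sigma_ring_sets I) \<Longrightarrow> (\<Union>i. A i) \<in> sigma_ring_sets I"

definition generating :: "'a measure \<Rightarrow> 'a set set \<Rightarrow> bool" where
  "generating S I \<longleftrightarrow> sigma_ring_sets I = sets S"

text \<open>A set function with domain \<open>L\<close> is a total function that is \<^const>\<open>undefined\<close> outside \<open>L\<close>, so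
  that equality of such functions is equality on \<open>L\<close>.\<close>

definition signed_measures :: "'a set set \<Rightarrow> ('a set \<Rightarrow> real) set" where
  "signed_measures L = {\<mu> \<in> extensional L. \<mu> {} = 0 \<and>
     (\<forall>A :: nat \<Rightarrow> 'a set. range A \<subseteq> L \<longrightarrow> disjoint_family A \<longrightarrow> (\<Union>k. A k) \<in> L \<longrightarrow>
        summable (\<lambda>k. \<bar>\<mu> (A k)\<bar>) \<and> \<mu> (\<Union>k. A k) = (\<Sum>k. \<mu> (A k)))}"

definition signed_measure_space :: "'a set set \<Rightarrow> ('a set \<Rightarrow> real) measure" where
  "signed_measure_space L =
     sigma (signed_measures L)
       {(\<lambda>\<mu>. \<mu> B) -` U \<inter> signed_measures L | B U. B \<in> L \<and> U \<in> sets borel}"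

lemma space_signed_measure_space: "space (signed_measure_space L) = signed_measures L"
  unfolding signed_measure_space_def by (subst space_measure_of) auto

lemma measurable_eval_signed_measure_space:
  assumes "B \<in> L"
  shows "(\<lambda>\<mu>. \<mu> B) \<in> borel_measurable (signed_measure_space L)"
proof (rule measurableI)
  fix U :: "real set"
  assume "U \<in> sets borel"
  then show "(\<lambda>\<mu>. \<mu> B) -` U \<inter> space (signed_measure_space L) \<in> sets (signed_measure_space L)"
    using assms unfolding space_signed_measure_space
    unfolding signed_measure_space_def by (subst sets_measure_of) auto
qed simp

end

theory Submission
  imports Defs
begin

text \<open>
  The point is that evaluation at an arbitrary \<open>B \<in> L\<close> is measurable with respect to the evaluations
  at members of \<open>I\<close>. Members of \<open>L\<close> need not be covered by finitely many members of \<open>I\<close>, so one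
  localizes first: for a fixed \<open>K \<in> I\<close>, the sets \<open>C\<close> for which \<open>\<mu> \<mapsto> \<mu> (C \<inter> K)\<close> is measurable form a
  Dynkin system containing \<open>I\<close>, hence comprise all measurable sets. Countably many members of \<open>I\<close>
  cover the space, and disjointifying them writes \<open>\<mu> B\<close> as a series of such evaluations.
  Consequently the law of a random signed measure is determined by that of its restriction to \<open>I\<close>,
  a process indexed by \<open>I\<close>.
\<close>

section \<open>Sigma-rings\<close>

text \<open>Countable covers survive differences and countable unions, the only operations of a
  sigma-ring; complements in an ambient space would break this. As the whole space is in the
  sigma-ring generated by \<open>I\<close>, it is covered by countably many members of
  \<open>I\<close>.\<close>

lemma sigma_ring_sets_countable_cover:
  assumes "A \<in> sigma_ring_sets I"
  shows "\<exists>D. countable D \<and> D \<subseteq> I \<and> A \<subseteq> \<Union>D"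
  using assms
proof (induction rule: sigma_ring_sets.induct)
  case (Basic A)
  then show ?case by (intro exI[of _ "{A}"]) auto
next
  case (Union A)
  then obtain D where D: "\<And>i. countable (D i) \<and> D i \<subseteq> I \<and> A i \<subseteq> \<Union>(D i)"
    by metis
  then show ?case
    by (intro exI[of _ "\<Union>i. D i"] conjI) (auto, blast)
next
  case Empty
  show ?case by (intro exI[of _ "{}"]) auto
next
  case (Diff A B)
  then show ?case by (meson Diff_subset order_trans)
qed

text \<open>This makes Dynkin induction, available for \<open>sigma_sets\<close>, applicable to
  every measurable set.\<close>

lemma sigma_ring_sets_subset_sigma_sets:
  assumes "I \<subseteq> Pow \<Omega>"
  shows "sigma_ring_sets I \<subseteq> sigma_sets \<Omega> I"
proof
  interpret sigma_algebra \<Omega> "sigma_sets \<Omega> I"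
    by (rule sigma_algebra_sigma_sets) fact
  fix A assume "A \<in> sigma_ring_sets I"
  then show "A \<in> sigma_sets \<Omega> I"
    by (induction rule: sigma_ring_sets.induct) (auto intro: sigma_sets.Basic)
qed

section \<open>Additivity of signed measures\<close>

lemma signed_measures_disjoint_Union:
  assumes "\<mu> \<in> signed_measures L" "range A \<subseteq> L" "disjoint_family A" "(\<Union>k::nat. A k) \<in> L"
  shows "\<mu> (\<Union>k. A k) = (\<Sum>k. \<mu> (A k))"
  using assms by (auto simp: signed_measures_def)

lemma signed_measures_Un:
  assumes "\<mu> \<in> signed_measures L" "A \<in> L" "B \<in> L" "A \<union> B \<in> L" "{} \<in> L" "A \<inter> B = {}"
  shows "\<mu> (A \<union> B) = \<mu> A + \<mu> B"
proof -
  have "\<mu> (\<Union>k. binaryset A B k) = (\<Sum>k. \<mu> (binaryset A B k))"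
    using assms
    by (intro signed_measures_disjoint_Union)
       (auto simp: binaryset_def disjoint_family_on_def split: if_splits)
  moreover have "\<mu> {} = 0"
    using assms(1) by (simp add: signed_measures_def)
  ultimately show ?thesis
    by (simp add: UN_binaryset_eq suminf_binaryset_eq)
qed

section \<open>Measurability of evaluations relative to the generating class\<close>

text \<open>The sigma-algebra generated by the evaluations at members of \<open>I\<close>. Encoding
  it as a pullback makes each of its members the preimage of a product-measurable set under
  restriction to \<open>I\<close>, which is how laws are compared at the end.\<close>

definition restricted_eval_algebra :: "'a set set \<Rightarrow> 'a set set \<Rightarrow> ('a set \<Rightarrow> real) measure" where
  "restricted_eval_algebra L I =
     vimage_algebra (signed_measures L) (\<lambda>\<mu>. restrict \<mu> I) (\<Pi>\<^sub>M i\<in>I. borel)"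

lemma space_restricted_eval_algebra [simp]:
  "space (restricted_eval_algebra L I) = signed_measures L"
  by (simp add: restricted_eval_algebra_def)

lemma measurable_eval_restricted:
  assumes "K \<in> I"
  shows "(\<lambda>\<mu>. \<mu> K) \<in> borel_measurable (restricted_eval_algebra L I)"
proof -
  have "(\<lambda>\<mu>. restrict \<mu> I) \<in> restricted_eval_algebra L I \<rightarrow>\<^sub>M (\<Pi>\<^sub>M i\<in>I. borel)"
    unfolding restricted_eval_algebra_def
    by (rule measurable_vimage_algebra1) (auto simp: space_PiM)
  from measurable_compose[OF this measurable_component_singleton[OF assms]] show ?thesis
    using assms by simp
qed

text \<open>Intersecting with \<open>K\<close> keeps every set of the Dynkin induction inside
  \<open>L\<close>. Without it, complements could leave the domain of the signed measures, since
  \<open>space S\<close> may fail to be in \<open>L\<close>.\<close>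

lemma measurable_eval_restricted_Int:
  assumes L: "localizing_ring S L" and I: "I \<subseteq> L" "Int_stable I" "generating S I"
    and K: "K \<in> I" and C: "C \<in> sets S"
  shows "(\<lambda>\<mu>. \<mu> (C \<inter> K)) \<in> borel_measurable (restricted_eval_algebra L I)"
proof -
  let ?G = "restricted_eval_algebra L I"
  have LS: "L \<subseteq> sets S" and Lint: "\<And>B C. B \<in> L \<Longrightarrow> C \<in> sets S \<Longrightarrow> C \<inter> B \<in> L"
    using L by (auto simp: localizing_ring_def Int_commute)
  interpret L: ring_of_sets "space S" L
    using L by (simp add: localizing_ring_def)
  have IP: "I \<subseteq> Pow (space S)"
    using I(1) L.space_closed by blast
  have sub: "sigma_sets (space S) I \<subseteq> sets S"
    using I(1) LS by (intro sets.sigma_sets_subset) auto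
  have KL: "K \<in> L"
    using K I by auto
  have C': "C \<in> sigma_sets (space S) I"
    using sigma_ring_sets_subset_sigma_sets[OF IP] C I(3) by (auto simp: generating_def)
  show ?thesis
    using I(2) IP C'
  proof (induction rule: sigma_sets_induct_disjoint)
    case (basic A)
    then show ?case
      using I(2) K by (intro measurable_eval_restricted) (auto simp: Int_stable_def)
  next
    case empty
    have "(\<lambda>\<mu>. 0 :: real) \<in> borel_measurable ?G" by simp
    then show ?case
      by (rule measurable_cong[THEN iffD1, rotated]) (simp add: signed_measures_def)
  next
    case (compl A)
    have A: "A \<in> sets S" using compl sub by auto
    \<comment> \<open>Relative to \<open>K\<close>, complementation is subtraction from the real
      number \<open>\<mu> K\<close>.\<close>
    have "(\<lambda>\<mu>. \<mu> K - \<mu> (A \<inter> K)) \<in> borel_measurable ?G"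
      using compl measurable_eval_restricted[OF K] by (intro borel_measurable_diff) auto
    moreover have "\<mu> K - \<mu> (A \<inter> K) = \<mu> ((space S - A) \<inter> K)" if "\<mu> \<in> signed_measures L" for \<mu>
    proof -
      have eq: "A \<inter> K \<union> (space S - A) \<inter> K = K"
        using KL L.space_closed by auto
      have "\<mu> (A \<inter> K \<union> (space S - A) \<inter> K) = \<mu> (A \<inter> K) + \<mu> ((space S - A) \<inter> K)"
        using that A KL Lint by (intro signed_measures_Un[of _ L]) (auto simp: eq)
      then show ?thesis by (simp add: eq)
    qed
    ultimately show ?case
      by (subst (asm) measurable_cong) auto
  next
    case (union A)
    have A: "A i \<in> sets S" for i using union sub by auto
    have "(\<lambda>\<mu>. \<Sum>i. \<mu> (A i \<inter> K)) \<in> borel_measurable ?G"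
      using union by (intro borel_measurable_suminf) auto
    moreover have "(\<Sum>i. \<mu> (A i \<inter> K)) = \<mu> ((\<Union>i. A i) \<inter> K)" if "\<mu> \<in> signed_measures L" for \<mu>
    proof -
      \<comment> \<open>Countable additivity requires the union to lie in \<open>L\<close>, which
        need not be closed under countable unions; here it does, being a measurable set intersected
        with \<open>K\<close>.\<close>
      have "\<mu> (\<Union>i. A i \<inter> K) = (\<Sum>i. \<mu> (A i \<inter> K))"
        using that union(1) A KL Lint Lint[OF KL sets.countable_UN[of A UNIV S]]
        by (intro signed_measures_disjoint_Union[of _ L])
           (auto simp: disjoint_family_on_def)
      then show ?thesis by simp
    qed
    ultimately show ?case
      by (subst (asm) measurable_cong) auto
  qed
qed

lemma measurable_eval_restricted_all:
  assumes L: "localizing_ring S L" and I: "I \<subseteq> L" "Int_stable I" "generating S I"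
    and B: "B \<in> L"
  shows "(\<lambda>\<mu>. \<mu> B) \<in> borel_measurable (restricted_eval_algebra L I)"
\<comment> \<open>Enumerating a cover as a sequence takes a member of \<open>I\<close>. If there is
  none, the covering lemma leaves only the empty measurable set.\<close>
proof (cases "I = {}")
  case True
  have "A = {}" if "A \<in> sigma_ring_sets I" for A
    using sigma_ring_sets_countable_cover[OF that] True by auto
  moreover have "B \<in> sets S"
    using B L by (auto simp: localizing_ring_def)
  ultimately have "B = {}"
    using I(3) by (auto simp: generating_def)
  have "(\<lambda>\<mu>. 0 :: real) \<in> borel_measurable (restricted_eval_algebra L I)" by simp
  then show ?thesis
    by (rule measurable_cong[THEN iffD1, rotated]) (simp add: signed_measures_def \<open>B = {}\<close>)
next
  case False
  have LS: "L \<subseteq> sets S" and Lint: "\<And>B C. B \<in> L \<Longrightarrow> C \<in> sets S \<Longrightarrow> C \<inter> B \<in> L"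
    using L by (auto simp: localizing_ring_def Int_commute)
  have "space S \<in> sigma_ring_sets I"
    using I(3) by (simp add: generating_def)
  from sigma_ring_sets_countable_cover[OF this]
  obtain D where D: "countable D" "D \<subseteq> I" "space S \<subseteq> \<Union>D"
    by blast
  obtain k where "k \<in> I" using False by auto
  \<comment> \<open>Inserting \<open>k\<close> guards against an empty \<open>D\<close>, possible
    when the space is empty: \<open>from_nat_into\<close> enumerates exactly the given set only if
    that set is nonempty.\<close>
  define A where "A = from_nat_into (insert k D)"
  have rA: "range A = insert k D"
    unfolding A_def using D by (intro range_from_nat_into) auto
  have AI: "A n \<in> I" for n 
  proof -
    have "A n \<in> insert k D"
      unfolding rA[symmetric] by (rule rangeI)
    then show ?thesis
      using D(2) \<open>k \<in> I\<close> by blast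
  qed
  have AS: "A n \<in> sets S" for n using AI I(1) LS by blast
  \<comment> \<open>The intersection with \<open>A n\<close> is redundant, but exhibits \<open>E n\<close> as \<open>C \<inter> K\<close> with \<open>K \<in> I\<close>.\<close>
  define E where "E n = (disjointed A n \<inter> B) \<inter> A n" for n
  \<comment> \<open>The disjointed pieces may leave \<open>I\<close>; measurability suffices, as
    they only serve as the factor \<open>C\<close> in \<open>C \<inter> K\<close>.\<close>
  have dS: "disjointed A n \<in> sets S" for n
    using AS sets.range_disjointed_sets[of A S] by auto
  have BS: "B \<in> sets S" using B LS by auto
  have E_eq: "E n = disjointed A n \<inter> B" for n
    using disjointed_subset[of A n] by (auto simp: E_def)
  have UE: "(\<Union>n. E n) = B"
  proof -
    have "B \<subseteq> (\<Union>n. A n)"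
      using D(3) sets.sets_into_space[OF BS] unfolding rA by auto
    moreover have "(\<Union>n. E n) = (\<Union>n. disjointed A n) \<inter> B"
      by (auto simp: E_eq)
    ultimately show ?thesis
      unfolding UN_disjointed_eq by blast
  qed
  have "(\<lambda>\<mu>. \<Sum>n. \<mu> (E n)) \<in> borel_measurable (restricted_eval_algebra L I)"
    unfolding E_def using AI dS BS
    by (intro borel_measurable_suminf measurable_eval_restricted_Int[OF L I]) auto
  moreover have "(\<Sum>n. \<mu> (E n)) = \<mu> B" if "\<mu> \<in> signed_measures L" for \<mu>
  proof -
    have "disjoint_family E"
      by (rule disjoint_family_subset[OF disjoint_family_disjointed[of A]]) (simp add: E_eq)
    moreover have "range E \<subseteq> L"
      using Lint[OF B dS] by (auto simp: E_eq)
    ultimately have "\<mu> (\<Union>n. E n) = (\<Sum>n. \<mu> (E n))"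
      using that B UE by (intro signed_measures_disjoint_Union[of _ L]) auto
    then show ?thesis by (simp add: UE)
  qed
  ultimately show ?thesis
    by (subst (asm) measurable_cong) auto
qed

text \<open>Each generator of the left side is a preimage under one evaluation, so the preceding
  lemma puts it in the right side.\<close>

lemma sets_signed_measure_space_subset:
  assumes "localizing_ring S L" "I \<subseteq> L" "Int_stable I" "generating S I"
  shows "sets (signed_measure_space L) \<subseteq> sets (restricted_eval_algebra L I)"
proof -
  have "{(\<lambda>\<mu>. \<mu> B) -` U \<inter> signed_measures L | B U. B \<in> L \<and> U \<in> sets borel}
      \<subseteq> sets (restricted_eval_algebra L I)"
    using measurable_sets[OF measurable_eval_restricted_all[OF assms]] by auto
  then have "sigma_sets (space (restricted_eval_algebra L I))
      {(\<lambda>\<mu>. \<mu> B) -` U \<inter> signed_measures L | B U. B \<in> L \<and> U \<in> sets borel}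
      \<subseteq> sets (restricted_eval_algebra L I)"
    by (rule sets.sigma_sets_subset)
  then show ?thesis
    unfolding signed_measure_space_def by (subst sets_measure_of) auto
qed

section \<open>Finite-dimensional laws\<close>

lemma measurable_signed_measure_space_tuple:
  assumes "\<And>i. i \<in> T \<Longrightarrow> J i \<in> L"
  shows "(\<lambda>\<mu>. \<lambda>i\<in>T. \<mu> (J i)) \<in> signed_measure_space L \<rightarrow>\<^sub>M (\<Pi>\<^sub>M i\<in>T. borel)"
  using assms by (intro measurable_restrict measurable_eval_signed_measure_space)

text \<open>Cylinders over finite sets of indices form an intersection-stable generator of the
  product sigma-algebra, so finite measures agreeing on them coincide. A cylinder event is a
  rectangle event for a tuple listing its indices.\<close>

lemma distr_PiM_eq_of_finite_tuples:
  fixes X :: "'b \<Rightarrow> 'i \<Rightarrow> real" and Y :: "'c \<Rightarrow> 'i \<Rightarrow> real"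
  assumes M: "prob_space M" and N: "prob_space N"
    and X: "\<And>i. i \<in> I \<Longrightarrow> (\<lambda>\<omega>. X \<omega> i) \<in> borel_measurable M"
    and Y: "\<And>i. i \<in> I \<Longrightarrow> (\<lambda>\<omega>. Y \<omega> i) \<in> borel_measurable N"
    and eq: "\<And>(n::nat) J. (\<forall>i\<in>{1..n}. J i \<in> I) \<Longrightarrow>
      distr M (\<Pi>\<^sub>M i\<in>{1..n}. borel) (\<lambda>\<omega>. \<lambda>i\<in>{1..n}. X \<omega> (J i)) =
      distr N (\<Pi>\<^sub>M i\<in>{1..n}. borel) (\<lambda>\<omega>. \<lambda>i\<in>{1..n}. Y \<omega> (J i))"
  shows "distr M (\<Pi>\<^sub>M i\<in>I. borel) (\<lambda>\<omega>. restrict (X \<omega>) I) =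
    distr N (\<Pi>\<^sub>M i\<in>I. borel) (\<lambda>\<omega>. restrict (Y \<omega>) I)"
proof (rule measure_eqI_PiM_infinite)
  have mX: "(\<lambda>\<omega>. restrict (X \<omega>) I) \<in> M \<rightarrow>\<^sub>M (\<Pi>\<^sub>M i\<in>I. borel)"
    and mY: "(\<lambda>\<omega>. restrict (Y \<omega>) I) \<in> N \<rightarrow>\<^sub>M (\<Pi>\<^sub>M i\<in>I. borel)"
    using X Y by (auto intro: measurable_restrict)
  show "finite_measure (distr M (\<Pi>\<^sub>M i\<in>I. borel) (\<lambda>\<omega>. restrict (X \<omega>) I))"
    using prob_space.prob_space_distr[OF M mX] by (rule prob_space.finite_measure)
  fix A :: "'i \<Rightarrow> real set" and F
  assume F: "finite F" "F \<subseteq> I" and A: "\<And>i. i \<in> F \<Longrightarrow> A i \<in> sets borel"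
  \<comment> \<open>Listing \<open>F\<close> as \<open>h 1, ..., h n\<close> gives the tuple to
    which \<open>eq\<close> applies; an empty \<open>F\<close> corresponds to
    \<open>n = 0\<close>.\<close>
  obtain h and n :: nat where h: "bij_betw h {1..n} F"
    using ex_bij_betw_nat_finite_1[OF F(1)] by blast
  let ?T = "{1..n}"
  have hF: "h ` ?T = F" using h by (simp add: bij_betw_def)
  have hI: "\<forall>i\<in>?T. h i \<in> I" using hF F(2) by blast
  have B: "Pi\<^sub>E ?T (\<lambda>i. A (h i)) \<in> sets (\<Pi>\<^sub>M i\<in>?T. borel)"
    using A unfolding hF[symmetric] by (intro sets_PiM_I_finite) blast+
  have E: "prod_emb I (\<lambda>_. borel) F (Pi\<^sub>E F A) \<in> sets (\<Pi>\<^sub>M i\<in>I. borel)"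
    using F A by (intro sets_PiM_I) auto
  \<comment> \<open>Stated for a generic process because \<open>M\<close> and \<open>N\<close> live
    on different types. Both sides measure the event that \<open>Z \<omega> i \<in> A i\<close> for
    all \<open>i \<in> F\<close>.\<close>
  have key: "emeasure (distr P (\<Pi>\<^sub>M i\<in>I. borel) (\<lambda>\<omega>. restrict (Z \<omega>) I))
        (prod_emb I (\<lambda>_. borel) F (Pi\<^sub>E F A)) =
      emeasure (distr P (\<Pi>\<^sub>M i\<in>?T. borel) (\<lambda>\<omega>. \<lambda>i\<in>?T. Z \<omega> (h i))) (Pi\<^sub>E ?T (\<lambda>i. A (h i)))"
    if Z: "\<And>i. i \<in> I \<Longrightarrow> (\<lambda>\<omega>. Z \<omega> i) \<in> borel_measurable P" for P and Z :: "'d \<Rightarrow> 'i \<Rightarrow> real"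
  proof -
    have "(\<lambda>\<omega>. restrict (Z \<omega>) I) -` prod_emb I (\<lambda>_. borel) F (Pi\<^sub>E F A) \<inter> space P =
        (\<lambda>\<omega>. \<lambda>i\<in>?T. Z \<omega> (h i)) -` (Pi\<^sub>E ?T (\<lambda>i. A (h i))) \<inter> space P"
      using F(2) hI unfolding hF[symmetric]
      by (auto simp: prod_emb_def PiE_iff extensional_def restrict_def)
    moreover have "(\<lambda>\<omega>. restrict (Z \<omega>) I) \<in> P \<rightarrow>\<^sub>M (\<Pi>\<^sub>M i\<in>I. borel)"
      using Z by (auto intro: measurable_restrict)
    moreover have "(\<lambda>\<omega>. \<lambda>i\<in>?T. Z \<omega> (h i)) \<in> P \<rightarrow>\<^sub>M (\<Pi>\<^sub>M i\<in>?T. borel)"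
      using Z hI by (auto intro: measurable_restrict)
    ultimately show ?thesis
      using B E by (simp only: emeasure_distr)
  qed
  show "emeasure (distr M (\<Pi>\<^sub>M i\<in>I. borel) (\<lambda>\<omega>. restrict (X \<omega>) I))
        (prod_emb I (\<lambda>_. borel) F (Pi\<^sub>E F A)) =
      emeasure (distr N (\<Pi>\<^sub>M i\<in>I. borel) (\<lambda>\<omega>. restrict (Y \<omega>) I))
        (prod_emb I (\<lambda>_. borel) F (Pi\<^sub>E F A))"
    using key[of X M] key[of Y N] X Y eq[OF hI] by simp
qed auto

section \<open>Equality of laws of random signed measures\<close>

theorem proposition2p16:
  fixes S :: "'a measure" and L I :: "'a set set"
    and M :: "'b measure" and N :: "'c measure"
    and \<xi> :: "'b \<Rightarrow> 'a set \<Rightarrow> real" and \<eta> :: "'c \<Rightarrow> 'a set \<Rightarrow> real"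
  assumes "localized_Borel_space S L"
    and "I \<subseteq> L" and "semiring_of_sets (space S) I" and "generating S I"
    and "prob_space M" and "\<xi> \<in> M \<rightarrow>\<^sub>M signed_measure_space L"
    and "prob_space N" and "\<eta> \<in> N \<rightarrow>\<^sub>M signed_measure_space L"
  shows "distr M (signed_measure_space L) \<xi> = distr N (signed_measure_space L) \<eta> \<longleftrightarrow>
    (\<forall>(n::nat) (J :: nat \<Rightarrow> 'a set). (\<forall>i \<in> {1..n}. J i \<in> I) \<longrightarrow>
      distr M (\<Pi>\<^sub>M i \<in> {1..n}. borel) (\<lambda>\<omega>. \<lambda>i \<in> {1..n}. \<xi> \<omega> (J i)) =
      distr N (\<Pi>\<^sub>M i \<in> {1..n}. borel) (\<lambda>\<omega>. \<lambda>i \<in> {1..n}. \<eta> \<omega> (J i)))"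
    (is "?law \<longleftrightarrow> ?fdd")
proof
  let ?Q = "signed_measure_space L"
  assume law: ?law
  show ?fdd
  proof (intro allI impI)
    fix n :: nat and J :: "nat \<Rightarrow> 'a set"
    assume "\<forall>i \<in> {1..n}. J i \<in> I"
    then have "(\<lambda>\<mu>. \<lambda>i\<in>{1..n}. \<mu> (J i)) \<in> ?Q \<rightarrow>\<^sub>M (\<Pi>\<^sub>M i\<in>{1..n}. borel)"
      using assms(2) by (intro measurable_signed_measure_space_tuple) auto
    \<comment> \<open>The law of the tuple is the image of the law on \<open>?Q\<close> under a
      measurable map.\<close>
    note distr_distr[OF this assms(6)] distr_distr[OF this assms(8)]
    then show "distr M (\<Pi>\<^sub>M i \<in> {1..n}. borel) (\<lambda>\<omega>. \<lambda>i \<in> {1..n}. \<xi> \<omega> (J i)) =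
      distr N (\<Pi>\<^sub>M i \<in> {1..n}. borel) (\<lambda>\<omega>. \<lambda>i \<in> {1..n}. \<eta> \<omega> (J i))"
      using law by (simp add: comp_def)
  qed
next
  let ?Q = "signed_measure_space L" and ?P = "\<Pi>\<^sub>M i\<in>I. (borel :: real measure)"
  assume fdd: ?fdd
  have L: "localizing_ring S L"
    using assms(1) by (simp add: localized_Borel_space_def)
  have I: "Int_stable I"
    using semiring_of_sets.Int[OF assms(3)] by (auto simp: Int_stable_def)
  have ev: "(\<lambda>\<omega>. \<xi> \<omega> i) \<in> borel_measurable M" "(\<lambda>\<omega>. \<eta> \<omega> i) \<in> borel_measurable N" if "i \<in> I" for i
    using that assms(2) measurable_eval_signed_measure_space[of i L] assms(6,8)
    by (auto intro: measurable_compose)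
  have eq: "distr M ?P (\<lambda>\<omega>. restrict (\<xi> \<omega>) I) = distr N ?P (\<lambda>\<omega>. restrict (\<eta> \<omega>) I)"
    by (rule distr_PiM_eq_of_finite_tuples[OF assms(5,7) ev fdd[rule_format]]) auto
  show ?law
  proof (rule measure_eqI)
    fix X assume "X \<in> sets (distr M ?Q \<xi>)"
    then have X: "X \<in> sets ?Q" by simp
    then have "X \<in> sets (restricted_eval_algebra L I)"
      using sets_signed_measure_space_subset[OF L assms(2) I assms(4)] by auto
    \<comment> \<open>Members of a pullback sigma-algebra are single preimages, so whether
      \<open>\<mu>\<close> is in \<open>X\<close> depends only on its restriction to
      \<open>I\<close>.\<close>
    then obtain Y where Y: "Y \<in> sets ?P" "X = (\<lambda>\<mu>. restrict \<mu> I) -` Y \<inter> signed_measures L"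
      unfolding restricted_eval_algebra_def
      by (subst (asm) sets_vimage_algebra2) (auto simp: space_PiM)
    have key: "emeasure (distr R ?Q \<zeta>) X = emeasure (distr R ?P (\<lambda>\<omega>. restrict (\<zeta> \<omega>) I)) Y"
      if \<zeta>: "\<zeta> \<in> R \<rightarrow>\<^sub>M ?Q" "\<And>i. i \<in> I \<Longrightarrow> (\<lambda>\<omega>. \<zeta> \<omega> i) \<in> borel_measurable R"
      for R and \<zeta> :: "'d \<Rightarrow> 'a set \<Rightarrow> real"
    proof -
      \<comment> \<open>The two events agree since \<open>\<zeta>\<close> takes values in
        \<open>signed_measures L\<close>, where membership in \<open>X\<close> means that the
        restriction lies in \<open>Y\<close>.\<close>
      have "(\<lambda>\<omega>. restrict (\<zeta> \<omega>) I) -` Y \<inter> space R = \<zeta> -` X \<inter> space R"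
        using measurable_space[OF \<zeta>(1)] Y(2) by (auto simp: space_signed_measure_space)
      moreover have "(\<lambda>\<omega>. restrict (\<zeta> \<omega>) I) \<in> R \<rightarrow>\<^sub>M ?P"
        using \<zeta>(2) by (auto intro: measurable_restrict)
      ultimately show ?thesis
        using X Y(1) \<zeta>(1) by (simp only: emeasure_distr)
    qed
    show "emeasure (distr M ?Q \<xi>) X = emeasure (distr N ?Q \<eta>) X"
      using key[OF assms(6)] key[OF assms(8)] ev eq by simp
  qed simp
qed

end
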